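(* Let $\omega:\mathbb{R}_+\to\mathbb{R}_+$ be an $A_2$-Muckenhoupt weight. Then there exists $C>0$ such that, for all $t\ge0$, $$\int_0^t\frac{d\tau}{\omega(\tau)}\le C(1+t^2).$$
   Context: $\mathbb{R}_+:=(0,+\infty)$. A function $\omega:\mathbb{R}_+\to\mathbb{R}_+$ is an $A_2$-Muckenhoupt weight if it is locally integrable and there is a constant $C'>0$ such that $\frac1{|I|^2}\big(\int_I\omega\big)\big(\int_I\frac1\omega\big)\le C'$ for all bounded intervals $I\subset\mathbb{R}_+$, where $|I|$ is the Lebesgue measure of $I$. *)

theory Defs
  imports "HOL-Analysis.Analysis"
begin

text \<open>A function on the open half-line \<open>\<real>\<^sub>+ = (0, \<infinity>)\<close> is rendered as a function of type
  \<open>real \<Rightarrow> real\<close>; its values outside \<open>{0<..}\<close> are irrelevant in everything below.\<close>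

definition locally_integrable_on :: "(real \<Rightarrow> real) \<Rightarrow> real set \<Rightarrow> bool"
    (infixr "locally'_integrable'_on" 46) where
  "f locally_integrable_on S \<longleftrightarrow>
     (\<forall>K. compact K \<and> K \<subseteq> S \<longrightarrow> f absolutely_integrable_on K)"

text \<open>The integrals over \<open>I\<close> are taken in \<open>[0, \<infinity>]\<close>, so that the inequality includes their
  finiteness: both integrands are positive on \<open>I\<close>, hence if one integral is infinite, so is the
  product. Intervals may be open, closed or half-open, and may have \<open>0\<close> as an endpoint;
  degenerate ones are excluded because of the division by \<open>|I|\<^sup>2\<close>.\<close>

definition A2_weight :: "(real \<Rightarrow> real) \<Rightarrow> bool" where
  "A2_weight \<omega> \<longleftrightarrow>
     (\<forall>x>0. \<omega> x > 0) \<and>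
     \<omega> locally_integrable_on {0<..} \<and>
     (\<exists>C'::real. C' > 0 \<and>
        (\<forall>I. is_interval I \<and> bounded I \<and> I \<subseteq> {0<..} \<and> emeasure lebesgue I > 0 \<longrightarrow>
           1 / (emeasure lebesgue I)\<^sup>2
             * (\<integral>\<^sup>+x\<in>I. ennreal (\<omega> x) \<partial>lebesgue)
             * (\<integral>\<^sup>+x\<in>I. ennreal (1 / \<omega> x) \<partial>lebesgue)
           \<le> ennreal C'))"

end

theory Submission
  imports Defs
begin

text \<open>The \<open>A\<^sub>2\<close> condition on \<open>(0, s)\<close> with \<open>s = max 1 t\<close> bounds \<open>\<integral>\<^sub>0\<^sup>s 1/\<omega>\<close> by
  \<open>C' s\<^sup>2 / \<integral>\<^sub>0\<^sup>s \<omega>\<close>, and the denominator is at least the fixed positive number \<open>\<integral>\<^sub>0\<^sup>1 \<omega>\<close>.\<close>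

text \<open>If the integral vanished, the integrand would be zero almost everywhere; since
  \<open>f\<close> is positive on \<open>K\<close>, this would make \<open>K\<close> a null
  set.\<close>

lemma nn_set_integral_pos:
  fixes f :: "real \<Rightarrow> real"
  assumes "f absolutely_integrable_on K" "K \<in> sets lebesgue" "emeasure lebesgue K > 0"
    and pos: "\<And>x. x \<in> K \<Longrightarrow> f x > 0"
  shows "(\<integral>\<^sup>+x\<in>K. ennreal (f x) \<partial>lebesgue) > 0"
proof (rule ccontr)
  have eq: "(\<lambda>x. ennreal (f x) * indicator K x) = (\<lambda>x. ennreal (indicat_real K x *\<^sub>R f x))"
    by (auto simp: indicator_def)
  have "(\<lambda>x. indicat_real K x *\<^sub>R f x) \<in> borel_measurable lebesgue"
    using assms(1) unfolding set_integrable_def by (rule borel_measurable_integrable)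
  then have meas: "(\<lambda>x. ennreal (f x) * indicator K x) \<in> borel_measurable lebesgue"
    unfolding eq by measurable
  assume "\<not> ?thesis"
  then have "AE x in lebesgue. ennreal (f x) * indicator K x = 0"
    using nn_integral_0_iff_AE[OF meas] by (simp add: not_less)
  then have "AE x in lebesgue. x \<notin> K"
    by eventually_elim (use pos in \<open>force simp: indicator_def ennreal_eq_0_iff split: if_splits\<close>)
  then have "emeasure lebesgue K = 0"
    using assms(2) by (subst (asm) AE_iff_measurable[of K]) auto
  with assms(3) show False by simp
qed

theorem lemma4p6:
  fixes \<omega> :: "real \<Rightarrow> real"
  assumes "A2_weight \<omega>"
  shows "\<exists>C::real. C > 0 \<and>
    (\<forall>t\<ge>0. (\<integral>\<^sup>+\<tau>\<in>{0<..<t}. ennreal (1 / \<omega> \<tau>) \<partial>lebesgue) \<le> ennreal (C * (1 + t\<^sup>2)))"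
proof -
  define W where "W t = (\<integral>\<^sup>+x\<in>{0<..<t}. ennreal (\<omega> x) \<partial>lebesgue)" for t
  define V where "V t = (\<integral>\<^sup>+x\<in>{0<..<t}. ennreal (1 / \<omega> x) \<partial>lebesgue)" for t
  obtain C' where "C' > 0" and A2:
    "\<And>I. is_interval I \<Longrightarrow> bounded I \<Longrightarrow> I \<subseteq> {0<..} \<Longrightarrow> emeasure lebesgue I > 0 \<Longrightarrow>
       1 / (emeasure lebesgue I)\<^sup>2
         * (\<integral>\<^sup>+x\<in>I. ennreal (\<omega> x) \<partial>lebesgue)
         * (\<integral>\<^sup>+x\<in>I. ennreal (1 / \<omega> x) \<partial>lebesgue) \<le> ennreal C'"
    using assms unfolding A2_weight_def by blast
  have W_mono: "W s \<le> W t" and V_mono: "V s \<le> V t" if "s \<le> t" for s t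
    using that unfolding W_def V_def by (auto intro!: nn_integral_mono simp: indicator_def)

  \<comment> \<open>Local integrability only speaks of compact subsets of the open half-line, so
    positivity is obtained on a compact interval inside (0, 1).\<close>
  have "0 < (\<integral>\<^sup>+x\<in>{1/2..3/4}. ennreal (\<omega> x) \<partial>lebesgue)"
    using assms unfolding A2_weight_def locally_integrable_on_def
    by (intro nn_set_integral_pos) (auto simp: subset_iff)
  also have "\<dots> \<le> W 1"
    unfolding W_def by (auto intro!: nn_integral_mono simp: indicator_def)
  \<comment> \<open>A real \<open>w\<close> strictly below \<open>W 1\<close> gives a finite
    positive divisor without deciding whether \<open>W 1\<close> is finite.\<close>
  finally obtain w where "0 < ennreal w" and wW: "ennreal w < W 1"
    by (metis dense ennreal_cases top.not_eq_extremum order_less_le_trans order_le_less_trans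
        top_greatest)
  then have "w > 0" by simp

  have main: "V s \<le> ennreal (C' / w * s\<^sup>2)" if "s \<ge> 1" for s
  proof -
    have "1 / (ennreal s)\<^sup>2 = ennreal (1 / s\<^sup>2)"
      using that by (simp add: ennreal_power divide_ennreal flip: ennreal_1)
    then have "ennreal (1 / s\<^sup>2) * W s * V s \<le> ennreal C'"
      using A2[of "{0<..<s}"] that unfolding W_def V_def
      by (auto simp: is_interval_oo subset_iff)
    moreover have "ennreal w \<le> W s"
      using wW W_mono[OF that] by simp
    ultimately have le: "ennreal (1 / s\<^sup>2) * ennreal w * V s \<le> ennreal C'"
      by (meson mult_left_mono mult_right_mono order_trans zero_le)
    \<comment> \<open>Multiplying by this finite inverse isolates \<open>V s\<close> in
      [0, \<infinity>], which stays valid before \<open>V s\<close> is known to be finite.\<close>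
    have "ennreal (s\<^sup>2 / w) * (ennreal (1 / s\<^sup>2) * ennreal w) = 1"
      using that \<open>w > 0\<close> by (simp flip: ennreal_mult')
    then have "V s = ennreal (s\<^sup>2 / w) * (ennreal (1 / s\<^sup>2) * ennreal w * V s)"
      by (metis mult.assoc mult_1)
    also have "\<dots> \<le> ennreal (s\<^sup>2 / w) * ennreal C'"
      by (intro mult_left_mono le) simp
    also have "\<dots> = ennreal (C' / w * s\<^sup>2)"
      using \<open>C' > 0\<close> by (subst ennreal_mult''[symmetric]) (simp_all add: mult.commute)
    finally show ?thesis .
  qed

  have "V t \<le> ennreal (C' / w * (1 + t\<^sup>2))" if "t \<ge> 0" for t
  proof -
    \<comment> \<open>\<open>main\<close> needs an endpoint of at least 1, so small \<open>t\<close>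
      is enlarged to 1. The constant survives because the square of \<open>max 1 t\<close> is at
      most 1 plus the square of \<open>t\<close>.\<close>
    have "V t \<le> ennreal (C' / w * (max 1 t)\<^sup>2)"
      using V_mono[of t "max 1 t"] main[of "max 1 t"]
      by (meson max.cobounded1 max.cobounded2 order_trans)
    also have "\<dots> \<le> ennreal (C' / w * (1 + t\<^sup>2))"
      using \<open>C' > 0\<close> \<open>w > 0\<close> by (intro ennreal_leI mult_left_mono) (auto simp: max_def)
    finally show ?thesis .
  qed
  then show ?thesis
    using \<open>C' > 0\<close> \<open>w > 0\<close> unfolding V_def by (intro exI[of _ "C' / w"]) auto
qed

end
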